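(* Let $R=\mathbb Z[u_{s,i}^{\pm1},u_{t,j}^{\pm1}]_{1\le i,j\le 3}$ and let $$H_{G_5}=\Big\langle s,t\ \Big|\ stst=tsts,\ \prod_{i=1}^3(s-u_{s,i})=\prod_{j=1}^3(t-u_{t,j})=0\Big\rangle$$ be the generic Hecke algebra (an associative unital $R$-algebra) of $G_5$. Let $u_1,u_2$ be the $R$-subalgebras generated by $s$ and by $t$ respectively, let $z=(st)^2$, and let $$U=\sum_{k=0}^5\big(z^ku_1u_2+z^kt^{-1}su_2\big).$$ Then $H_{G_5}=U$.
   Context: For subsets $X,Y$ of an $R$-algebra, $XY$ denotes the $R$-submodule spanned by the products $xy$. The generators are invertible in the algebra because the parameters are invertible in $R$. *)

theory Defs
  imports Complex_Main "HOL-Library.Poly_Mapping" "HOL-Library.Set_Algebras"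
begin

section \<open>The ring of Laurent polynomials in the parameters\<close>

datatype gen = S | T

datatype idx = I1 | I2 | I3

text \<open>A Laurent monomial is an integer exponent vector indexed by the six parameters, so the
  Laurent polynomial ring over the integers is the group ring of the free abelian group on
  them, with the convolution product of finitely supported functions.\<close>

type_synonym laurent = "((gen \<times> idx) \<Rightarrow>\<^sub>0 int) \<Rightarrow>\<^sub>0 int"

definition u :: "gen \<Rightarrow> idx \<Rightarrow> laurent" where
  "u g i = Poly_Mapping.single (Poly_Mapping.single (g, i) 1) 1"

definition u_inv :: "gen \<Rightarrow> idx \<Rightarrow> laurent" where
  "u_inv g i = Poly_Mapping.single (Poly_Mapping.single (g, i) (- 1)) 1"

lemma u_mult_u_inv [simp]: "u g i * u_inv g i = 1"
  unfolding u_def u_inv_def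
  by (simp add: mult_single flip: single_add)

lemma u_inv_mult_u [simp]: "u_inv g i * u g i = 1"
  by (subst mult.commute) (rule u_mult_u_inv)


section \<open>The free associative algebra on the two generators\<close>

text \<open>The free monoid is a copy of the type of lists, written additively because
  finitely supported functions on an additive monoid carry the convolution product.\<close>

datatype word = Word "gen list"

instantiation word :: monoid_add
begin

definition zero_word :: word where "0 = Word []"

fun plus_word :: "word \<Rightarrow> word \<Rightarrow> word" where
  "Word xs + Word ys = Word (xs @ ys)"

instance
proof
  fix a b c :: word
  show "a + b + c = a + (b + c)" by (cases a; cases b; cases c) simp
  show "0 + a = a" by (cases a) (simp add: zero_word_def)
  show "a + 0 = a" by (cases a) (simp add: zero_word_def)
qed

end

type_synonym free_alg = "word \<Rightarrow>\<^sub>0 laurent"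

definition fgen :: "gen \<Rightarrow> free_alg" where
  "fgen g = Poly_Mapping.single (Word [g]) 1"

definition fconst :: "laurent \<Rightarrow> free_alg" where
  "fconst c = Poly_Mapping.single 0 c"

lemma fconst_simps:
  "fconst 0 = 0" "fconst 1 = 1"
  "fconst (a + b) = fconst a + fconst b"
  "fconst (a * b) = fconst a * fconst b"
  by (simp_all add: fconst_def single_add mult_single)

lemma poly_mapping_add_induct [case_names zero add]:
  fixes p :: "'a \<Rightarrow>\<^sub>0 'b::comm_monoid_add"
  assumes "P 0" "\<And>w c p. P p \<Longrightarrow> P (Poly_Mapping.single w c + p)"
  shows "P p"
proof (induction p rule: update_induct)
  case const
  then show ?case by (rule assms)
next
  case (update f a b)
  have "Poly_Mapping.update a b f = Poly_Mapping.single a b + f"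
    using update(1) by (intro poly_mapping_eqI)
      (auto simp: lookup_update lookup_add lookup_single when_def not_in_keys_iff_lookup_eq_zero)
  then show ?case using update assms by simp
qed

lemma fconst_central: "fconst c * p = p * fconst c"
  by (induction p rule: poly_mapping_add_induct)
    (simp_all add: fconst_def distrib_left distrib_right mult_single mult.commute)


section \<open>The generic Hecke algebra\<close>

definition two_sided_ideal :: "'a::ring_1 set \<Rightarrow> bool" where
  "two_sided_ideal A \<longleftrightarrow>
     0 \<in> A \<and> (\<forall>x\<in>A. \<forall>y\<in>A. x + y \<in> A) \<and> (\<forall>x\<in>A. \<forall>a. a * x \<in> A \<and> x * a \<in> A)"

definition relators :: "free_alg set" where
  "relators =
    {fgen S * fgen T * fgen S * fgen T - fgen T * fgen S * fgen T * fgen S,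
     (fgen S - fconst (u S I1)) * (fgen S - fconst (u S I2)) * (fgen S - fconst (u S I3)),
     (fgen T - fconst (u T I1)) * (fgen T - fconst (u T I2)) * (fgen T - fconst (u T I3))}"

definition hecke_ideal :: "free_alg set" where
  "hecke_ideal = two_sided_ideal hull relators"

lemma two_sided_ideal_hecke_ideal: "two_sided_ideal hecke_ideal"
  unfolding hecke_ideal_def by (rule hull_in) (auto simp: two_sided_ideal_def)

lemma hecke_ideal_0: "0 \<in> hecke_ideal"
  and hecke_ideal_add: "x \<in> hecke_ideal \<Longrightarrow> y \<in> hecke_ideal \<Longrightarrow> x + y \<in> hecke_ideal"
  and hecke_ideal_left: "x \<in> hecke_ideal \<Longrightarrow> a * x \<in> hecke_ideal"
  and hecke_ideal_right: "x \<in> hecke_ideal \<Longrightarrow> x * a \<in> hecke_ideal"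
  using two_sided_ideal_hecke_ideal unfolding two_sided_ideal_def by auto

lemma hecke_ideal_uminus: "x \<in> hecke_ideal \<Longrightarrow> - x \<in> hecke_ideal"
  using hecke_ideal_left[of x "- 1"] by simp

lemma relators_hecke_ideal: "x \<in> relators \<Longrightarrow> x \<in> hecke_ideal"
  unfolding hecke_ideal_def by (rule hull_inc)

definition hecke_rel :: "free_alg \<Rightarrow> free_alg \<Rightarrow> bool" where
  "hecke_rel p q \<longleftrightarrow> p - q \<in> hecke_ideal"

quotient_type hecke = free_alg / hecke_rel
proof (rule equivpI)
  show "reflp hecke_rel"
    by (auto intro!: reflpI simp: hecke_rel_def hecke_ideal_0)
  show "symp hecke_rel"
    by (rule sympI) (use hecke_ideal_uminus in \<open>force simp: hecke_rel_def\<close>)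
  show "transp hecke_rel"
    by (rule transpI) (use hecke_ideal_add in \<open>force simp: hecke_rel_def\<close>)
qed

text \<open>The quotient is not the zero ring: mapping both generators to their first
  parameter defines a character.\<close>

fun eval_word :: "word \<Rightarrow> laurent" where
  "eval_word (Word xs) = prod_list (map (\<lambda>g. u g I1) xs)"

definition eval_free :: "free_alg \<Rightarrow> laurent" where
  "eval_free p = (\<Sum>w\<in>Poly_Mapping.keys p. Poly_Mapping.lookup p w * eval_word w)"

lemma eval_word_0 [simp]: "eval_word 0 = 1"
  by (simp add: zero_word_def)

lemma eval_word_add: "eval_word (v + w) = eval_word v * eval_word w"
  by (cases v; cases w) simp

lemma eval_free_superset:
  assumes "finite A" "Poly_Mapping.keys p \<subseteq> A"
  shows "eval_free p = (\<Sum>w\<in>A. Poly_Mapping.lookup p w * eval_word w)"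
  unfolding eval_free_def using assms
  by (intro sum.mono_neutral_left) (auto simp: not_in_keys_iff_lookup_eq_zero)

lemma eval_free_add: "eval_free (p + q) = eval_free p + eval_free q"
proof -
  let ?A = "Poly_Mapping.keys p \<union> Poly_Mapping.keys q"
  have "eval_free (p + q) = (\<Sum>w\<in>?A. Poly_Mapping.lookup (p + q) w * eval_word w)"
    by (rule eval_free_superset) (auto simp: Poly_Mapping.keys_add)
  moreover have "eval_free p = (\<Sum>w\<in>?A. Poly_Mapping.lookup p w * eval_word w)"
    by (rule eval_free_superset) auto
  moreover have "eval_free q = (\<Sum>w\<in>?A. Poly_Mapping.lookup q w * eval_word w)"
    by (rule eval_free_superset) auto
  ultimately show ?thesis
    by (simp add: lookup_add distrib_right sum.distrib)
qed

lemma eval_free_0: "eval_free 0 = 0"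
  by (simp add: eval_free_def)

lemma eval_free_single: "eval_free (Poly_Mapping.single w c) = c * eval_word w"
  by (cases "c = 0") (simp_all add: eval_free_def)

lemma eval_free_mult: "eval_free (p * q) = eval_free p * eval_free q"
proof (induction p rule: poly_mapping_add_induct)
  case zero
  then show ?case by (simp add: eval_free_0)
next
  case (add v c p)
  have "eval_free (Poly_Mapping.single v c * q) = c * eval_word v * eval_free q"
    by (induction q rule: poly_mapping_add_induct)
      (simp_all add: eval_free_0 distrib_left eval_free_add mult_single eval_free_single
        eval_word_add mult_ac)
  then show ?case using add
    by (simp add: distrib_right eval_free_add eval_free_single)
qed

lemma eval_free_diff: "eval_free (p - q) = eval_free p - eval_free q"
  using eval_free_add[of "p - q" q] by (simp add: algebra_simps)

lemma eval_free_hecke_ideal: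
  assumes "p \<in> hecke_ideal"
  shows "eval_free p = 0"
proof -
  have "relators \<subseteq> {p. eval_free p = 0}"
    by (auto simp: relators_def eval_free_mult eval_free_diff fgen_def fconst_def
        eval_free_single mult_ac)
  moreover have "two_sided_ideal {p. eval_free p = 0}"
    by (auto simp: two_sided_ideal_def eval_free_0 eval_free_add eval_free_mult)
  ultimately have "hecke_ideal \<subseteq> {p. eval_free p = 0}"
    unfolding hecke_ideal_def by (rule hull_minimal)
  with assms show ?thesis by auto
qed

lemma one_notin_hecke_ideal: "1 \<notin> hecke_ideal"
  using eval_free_hecke_ideal[of 1] eval_free_single[of 0 1] by auto

instantiation hecke :: ring_1
begin

lift_definition zero_hecke :: hecke is "0 :: free_alg" .

lift_definition one_hecke :: hecke is "1 :: free_alg" .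

lift_definition plus_hecke :: "hecke \<Rightarrow> hecke \<Rightarrow> hecke" is "(+) :: free_alg \<Rightarrow> _"
  unfolding hecke_rel_def
proof -
  fix a b c d :: free_alg
  assume "a - b \<in> hecke_ideal" "c - d \<in> hecke_ideal"
  then have "(a - b) + (c - d) \<in> hecke_ideal" by (rule hecke_ideal_add)
  then show "a + c - (b + d) \<in> hecke_ideal" by (simp add: algebra_simps)
qed

lift_definition uminus_hecke :: "hecke \<Rightarrow> hecke" is "uminus :: free_alg \<Rightarrow> _"
  unfolding hecke_rel_def using hecke_ideal_uminus by fastforce

lift_definition minus_hecke :: "hecke \<Rightarrow> hecke \<Rightarrow> hecke" is "(-) :: free_alg \<Rightarrow> _"
  unfolding hecke_rel_def
proof -
  fix a b c d :: free_alg
  assume "a - b \<in> hecke_ideal" "c - d \<in> hecke_ideal"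
  then have "(a - b) + - (c - d) \<in> hecke_ideal"
    by (intro hecke_ideal_add hecke_ideal_uminus)
  then show "a - c - (b - d) \<in> hecke_ideal" by (simp add: algebra_simps)
qed

lift_definition times_hecke :: "hecke \<Rightarrow> hecke \<Rightarrow> hecke" is "(*) :: free_alg \<Rightarrow> _"
  unfolding hecke_rel_def
proof -
  fix a b c d :: free_alg
  assume "a - b \<in> hecke_ideal" "c - d \<in> hecke_ideal"
  then have "(a - b) * c + b * (c - d) \<in> hecke_ideal"
    by (intro hecke_ideal_add hecke_ideal_left hecke_ideal_right)
  then show "a * c - b * d \<in> hecke_ideal" by (simp add: algebra_simps)
qed

instance
proof
  fix a b c :: hecke
  show "a + b + c = a + (b + c)"
    by transfer (simp add: hecke_rel_def hecke_ideal_0 algebra_simps)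
  show "a + b = b + a"
    by transfer (simp add: hecke_rel_def hecke_ideal_0 algebra_simps)
  show "0 + a = a"
    by transfer (simp add: hecke_rel_def hecke_ideal_0)
  show "- a + a = 0"
    by transfer (simp add: hecke_rel_def hecke_ideal_0)
  show "a - b = a + - b"
    by transfer (simp add: hecke_rel_def hecke_ideal_0)
  show "a * b * c = a * (b * c)"
    by transfer (simp add: hecke_rel_def hecke_ideal_0 mult.assoc)
  show "1 * a = a"
    by transfer (simp add: hecke_rel_def hecke_ideal_0)
  show "a * 1 = a"
    by transfer (simp add: hecke_rel_def hecke_ideal_0)
  show "(a + b) * c = a * c + b * c"
    by transfer (simp add: hecke_rel_def hecke_ideal_0 distrib_right)
  show "a * (b + c) = a * b + a * c"
    by transfer (simp add: hecke_rel_def hecke_ideal_0 distrib_left)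
  show "(0::hecke) \<noteq> 1"
    by transfer (use one_notin_hecke_ideal hecke_ideal_uminus in \<open>force simp: hecke_rel_def\<close>)
qed

end

lift_definition hgen :: "gen \<Rightarrow> hecke" is fgen .

lift_definition hconst :: "laurent \<Rightarrow> hecke" is fconst .

definition hscale :: "laurent \<Rightarrow> hecke \<Rightarrow> hecke" where
  "hscale c x = hconst c * x"

abbreviation s :: hecke where "s \<equiv> hgen S"

abbreviation t :: hecke where "t \<equiv> hgen T"

lemma hconst_simps:
  "hconst 0 = 0" "hconst 1 = 1"
  "hconst (a + b) = hconst a + hconst b"
  "hconst (a * b) = hconst a * hconst b"
proof -
  show "hconst 0 = 0" by transfer (simp add: fconst_simps hecke_rel_def hecke_ideal_0)
  show "hconst 1 = 1" by transfer (simp add: fconst_simps hecke_rel_def hecke_ideal_0)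
  show "hconst (a + b) = hconst a + hconst b"
    by transfer (simp add: fconst_simps hecke_rel_def hecke_ideal_0)
  show "hconst (a * b) = hconst a * hconst b"
    by transfer (simp add: fconst_simps hecke_rel_def hecke_ideal_0)
qed

lemma hconst_central: "hconst c * x = x * hconst c"
  by transfer (simp add: fconst_central hecke_rel_def hecke_ideal_0)

lemma hscale_mult_left: "hscale c x * y = hscale c (x * y)"
  by (simp add: hscale_def mult.assoc)

lemma hscale_mult_right: "x * hscale c y = hscale c (x * y)"
  by (simp add: hscale_def flip: mult.assoc) (simp add: hconst_central)

interpretation hecke: module hscale
  by standard (simp_all add: hscale_def hconst_simps distrib_left distrib_right mult.assoc)

lemma hecke_braid: "s * t * s * t = t * s * t * s"
  by transfer (simp add: hecke_rel_def relators_hecke_ideal relators_def)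

lemma hecke_cubic:
  "(hgen g - hconst (u g I1)) * (hgen g - hconst (u g I2)) * (hgen g - hconst (u g I3)) = 0"
  by (cases g; simp; transfer; simp add: hecke_rel_def relators_hecke_ideal relators_def)


section \<open>Inverses, subalgebras and products of subsets\<close>

text \<open>A type of class \<open>ring_1\<close> has no inversion operation, so the two-sided
  inverse is chosen by a description; it is meaningful only for units.\<close>

definition unit_inv :: "'a::monoid_mult \<Rightarrow> 'a" where
  "unit_inv x = (THE y. x * y = 1 \<and> y * x = 1)"

lemma unit_inv_eqI:
  assumes "x * y = 1" "y * x = 1"
  shows "unit_inv x = y"
  unfolding unit_inv_def
proof (rule the_equality)
  fix z assume z: "x * z = 1 \<and> z * x = 1"
  have "z = (y * x) * z" using assms by simp
  also have "\<dots> = y * (x * z)" by (simp only: mult.assoc)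
  finally show "z = y" using z by simp
qed (use assms in auto)

lemma hgen_unit: "\<exists>y. hgen g * y = 1 \<and> y * hgen g = 1"
proof -
  define x a b c where "x = hgen g" and "a = hconst (u g I1)"
    and "b = hconst (u g I2)" and "c = hconst (u g I3)"
  define d where "d = hconst (u_inv g I1 * u_inv g I2 * u_inv g I3)"
  define q where "q = x * x - (a + b + c) * x + (a * b + a * c + b * c)"
  have comm: "x * a = a * x" "x * b = b * x" "x * c = c * x"
    "b * a = a * b" "c * a = a * c" "c * b = b * c" "x * d = d * x"
    unfolding a_def b_def c_def d_def by (rule hconst_central[symmetric])+
  have comm': "x * (a * y) = a * (x * y)" "x * (b * y) = b * (x * y)" "x * (c * y) = c * (x * y)"
    "b * (a * y) = a * (b * y)" "c * (a * y) = a * (c * y)" "c * (b * y) = b * (c * y)" for y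
    by (simp_all only: comm flip: mult.assoc)
  have "(x - a) * (x - b) * (x - c) = x * q - a * b * c"
    by (simp add: q_def algebra_simps comm comm')
  then have xq: "x * q = a * b * c"
    using hecke_cubic[of g] by (simp add: x_def a_def b_def c_def)
  have qx: "q * x = x * q"
    by (simp add: q_def algebra_simps comm comm')
  have "u_inv g I1 * u_inv g I2 * u_inv g I3 * (u g I1 * u g I2 * u g I3)
      = (u_inv g I1 * u g I1) * (u_inv g I2 * u g I2) * (u_inv g I3 * u g I3)"
    by (simp only: mult_ac)
  then have "d * (a * b * c) = 1"
    by (simp only: d_def a_def b_def c_def flip: hconst_simps(4))
      (simp add: hconst_simps(2))
  then have dxq: "d * (x * q) = 1"
    by (simp only: xq)
  have "x * (d * q) = (x * d) * q" by (simp only: mult.assoc)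
  also have "\<dots> = d * (x * q)" by (simp only: comm) (simp only: mult.assoc)
  finally have "x * (d * q) = 1" using dxq by simp
  moreover have "(d * q) * x = 1"
    using dxq by (simp only: mult.assoc qx)
  ultimately have "x * (d * q) = 1 \<and> (d * q) * x = 1" ..
  then show ?thesis unfolding x_def by blast
qed

lemma hgen_inverse [simp]:
  "hgen g * unit_inv (hgen g) = 1" "unit_inv (hgen g) * hgen g = 1"
  using hgen_unit[of g] unit_inv_eqI by metis+

definition subalgebra :: "hecke set \<Rightarrow> bool" where
  "subalgebra A \<longleftrightarrow> hecke.subspace A \<and> 1 \<in> A \<and> (\<forall>x\<in>A. \<forall>y\<in>A. x * y \<in> A)"

text \<open>The product of two subsets is the submodule spanned by the elementwise products; it
  must not be confused with the elementwise product \<open>*\<close> on sets. The sum of submodules, in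
  contrast, is the elementwise sum \<open>+\<close> of sets.\<close>

definition span_prod :: "hecke set \<Rightarrow> hecke set \<Rightarrow> hecke set"  (infixl \<open>\<bullet>\<close> 70) where
  "X \<bullet> Y = hecke.span {x * y | x y. x \<in> X \<and> y \<in> Y}"

definition u1 :: "hecke set" where "u1 = subalgebra hull {s}"

definition u2 :: "hecke set" where "u2 = subalgebra hull {t}"

definition z :: hecke where "z = (s * t) ^ 2"

definition U :: "hecke set" where
  "U = (\<Sum>k\<in>{0..5::nat}. ({z ^ k} \<bullet> u1 \<bullet> u2) + ({z ^ k * unit_inv t * s} \<bullet> u2))"

end

theory Submission
  imports Defs
begin

text \<open>It suffices that \<open>U\<close> contains 1 and is stable under left multiplication by \<open>s\<close> and \<open>t\<close>.
  As \<open>U\<close> is stable under right multiplication by \<open>u\<^sub>2\<close>, only the products of \<open>s\<close> and \<open>t\<close> with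
  \<open>z\<^sup>k\<close>, \<open>z\<^sup>k s\<close>, \<open>z\<^sup>k s\<^sup>-\<^sup>1\<close> and \<open>z\<^sup>k t\<^sup>-\<^sup>1 s\<close> matter, and the difficulty is to keep the exponent
  of the central element \<open>z\<close> between 0 and 5. Everything comes from one relation, which expresses
  \<open>z\<^sup>2 t\<^sup>-\<^sup>1 s t\<^sup>-\<^sup>1\<close> as a unit multiple of \<open>s t\<^sup>-\<^sup>1 s\<close> plus terms in \<open>z\<^sup>j u\<^sub>1 u\<^sub>2\<close> with
  \<open>j \<le> 2\<close>.
  Multiplied on the left by \<open>x\<close>, it trades \<open>z\<^sup>k x s t\<^sup>-\<^sup>1 s\<close> for \<open>z\<^sup>k\<^sup>+\<^sup>2 x t\<^sup>-\<^sup>1 s\<close> and conversely. The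
  cubic relation for \<open>s\<close> turns \<open>s\<^sup>2\<close> into \<open>s\<^sup>-\<^sup>1\<close>, and \<open>s\<^sup>-\<^sup>1 t\<^sup>-\<^sup>1\<close> and \<open>t\<^sup>-\<^sup>1 s\<^sup>-\<^sup>1\<close> equal
  \<open>z\<^sup>-\<^sup>1 t s\<close> and \<open>z\<^sup>-\<^sup>1 s t\<close>, so repeating the trade ends in \<open>U\<close>.\<close>

section \<open>Subspaces and subalgebras\<close>

text \<open>Words in \<open>s\<close> and \<open>t\<close> span the algebra over its coefficients.
  This serves both for \<open>U\<close> and for the commutant of \<open>z\<close>.\<close>

lemma hecke_induct:
  assumes W: "hecke.subspace W" "1 \<in> W" "\<And>x. x \<in> W \<Longrightarrow> s * x \<in> W" "\<And>x. x \<in> W \<Longrightarrow> t * x \<in> W"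
  shows "x \<in> W"
proof -
  have word: "abs_hecke (Poly_Mapping.single (Word gs) 1) \<in> W" for gs
  proof (induction gs)
    case Nil
    then show ?case
      using W(2) by (simp add: one_hecke_def flip: zero_word_def)
  next
    case (Cons g gs)
    have "abs_hecke (Poly_Mapping.single (Word (g # gs)) 1)
        = hgen g * abs_hecke (Poly_Mapping.single (Word gs) 1)"
      by (simp add: hgen.abs_eq times_hecke.abs_eq fgen_def mult_single)
    then show ?case
      using Cons W(3,4) by (cases g) auto
  qed
  have "abs_hecke p \<in> W" for p
  proof (induction p rule: poly_mapping_add_induct)
    case zero
    then show ?case
      using hecke.subspace_0[OF W(1)] by (simp add: zero_hecke_def)
  next
    case (add v c p)
    obtain gs where v: "v = Word gs" by (cases v)
    have "abs_hecke (Poly_Mapping.single v c + p)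
        = hscale c (abs_hecke (Poly_Mapping.single (Word gs) 1)) + abs_hecke p"
      by (simp add: v hscale_def hconst.abs_eq fconst_def times_hecke.abs_eq plus_hecke.abs_eq
          mult_single)
    then show ?case
      using add word W(1) hecke.subspace_add hecke.subspace_scale by metis
  qed
  then show ?thesis by (induction x rule: hecke.abs_induct)
qed

lemma subspace_mult_left_vimage:
  "hecke.subspace W \<Longrightarrow> hecke.subspace {y. x * y \<in> W}"
  by (auto simp: hecke.subspace_def distrib_left hscale_mult_right)

lemma subspace_mult_right_vimage:
  "hecke.subspace W \<Longrightarrow> hecke.subspace {y. y * x \<in> W}"
  by (auto simp: hecke.subspace_def distrib_right hscale_mult_left)

text \<open>The elements whose left multiplication preserves \<open>M\<close> form a subalgebra
  containing \<open>hgen g\<close>; applying them to 1 lands in \<open>M\<close>.\<close>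

lemma subalgebra_hull_subset:
  assumes M: "hecke.subspace M" "1 \<in> M" "\<And>x. x \<in> M \<Longrightarrow> hgen g * x \<in> M"
  shows "subalgebra hull {hgen g} \<subseteq> M"
proof -
  let ?X = "{x. \<forall>y\<in>M. x * y \<in> M}"
  have "hecke.subspace ?X"
    using M(1) by (auto simp: hecke.subspace_def distrib_right hscale_mult_left)
  then have "subalgebra ?X"
    by (auto simp: subalgebra_def mult.assoc)
  then have "subalgebra hull {hgen g} \<subseteq> ?X"
    using M(3) by (intro hull_minimal) auto
  then show ?thesis
    using M(2) by force
qed

lemma subalgebra_hull: "subalgebra (subalgebra hull A)"
  by (rule hull_in) (auto simp: subalgebra_def hecke.subspace_def)

lemma subspace_set_plus:
  assumes "hecke.subspace A" "hecke.subspace B"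
  shows "hecke.subspace (A + B)"
proof (rule hecke.subspaceI)
  show "0 \<in> A + B"
    using set_plus_intro[of 0 A 0 B] assms hecke.subspace_0 by simp
next
  fix x y assume "x \<in> A + B" "y \<in> A + B"
  then obtain a b c d where "a \<in> A" "b \<in> B" "c \<in> A" "d \<in> B" "x = a + b" "y = c + d"
    by (elim set_plus_elim)
  then show "x + y \<in> A + B"
    using set_plus_intro[of "a + c" A "b + d" B] assms hecke.subspace_add
    by (simp add: algebra_simps)
next
  fix c x assume "x \<in> A + B"
  then obtain a b where "a \<in> A" "b \<in> B" "x = a + b"
    by (elim set_plus_elim)
  then show "hscale c x \<in> A + B"
    using set_plus_intro[of "hscale c a" A "hscale c b" B] assms hecke.subspace_scale
    by (simp add: hecke.scale_right_distrib)
qed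

lemma subspace_set_sum:
  "finite I \<Longrightarrow> (\<And>i. i \<in> I \<Longrightarrow> hecke.subspace (F i)) \<Longrightarrow> hecke.subspace (\<Sum>i\<in>I. F i)"
  by (induction I rule: finite_induct) (simp_all add: subspace_set_plus set_zero)

lemma set_plus_subset:
  assumes "hecke.subspace W" "A \<subseteq> W" "B \<subseteq> W"
  shows "A + B \<subseteq> W"
  using assms by (auto simp: hecke.subspace_def elim!: set_plus_elim)

lemma set_sum_subset:
  "finite I \<Longrightarrow> hecke.subspace W \<Longrightarrow> (\<And>i. i \<in> I \<Longrightarrow> F i \<subseteq> W) \<Longrightarrow> (\<Sum>i\<in>I. F i) \<subseteq> W"
  by (induction I rule: finite_induct) (simp_all add: set_zero hecke.subspace_0 set_plus_subset)

lemma subset_set_sum: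
  assumes "finite I" "i \<in> I" "\<And>i. i \<in> I \<Longrightarrow> hecke.subspace (F i)"
  shows "F i \<subseteq> (\<Sum>i\<in>I. F i)"
proof
  fix x assume "x \<in> F i"
  moreover have "0 \<in> (\<Sum>i\<in>I - {i}. F i)"
    using assms by (intro hecke.subspace_0 subspace_set_sum) auto
  ultimately have "x + 0 \<in> F i + (\<Sum>i\<in>I - {i}. F i)"
    by (rule set_plus_intro)
  then show "x \<in> (\<Sum>i\<in>I. F i)"
    using sum.remove[OF assms(1,2), of F] by simp
qed

lemma span_prod_memI: "x \<in> X \<Longrightarrow> y \<in> Y \<Longrightarrow> x * y \<in> X \<bullet> Y"
  unfolding span_prod_def by (rule hecke.span_base) blast

lemma subspace_span_prod: "hecke.subspace (X \<bullet> Y)"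
  by (simp add: span_prod_def hecke.subspace_span)

lemma span_prod_subset:
  assumes "hecke.subspace W" "\<And>x y. x \<in> X \<Longrightarrow> y \<in> Y \<Longrightarrow> x * y \<in> W"
  shows "X \<bullet> Y \<subseteq> W"
  unfolding span_prod_def by (rule hecke.span_minimal) (use assms in auto)

section \<open>Relations in the Hecke algebra\<close>

abbreviation s_inv :: hecke where "s_inv \<equiv> unit_inv s"

abbreviation t_inv :: hecke where "t_inv \<equiv> unit_inv t"

lemma hgen_inverse_cancel [simp]:
  "hgen g * (unit_inv (hgen g) * x) = x" "unit_inv (hgen g) * (hgen g * x) = x"
  by (simp_all flip: mult.assoc)

definition c2 :: "gen \<Rightarrow> laurent" where "c2 g = u g I1 + u g I2 + u g I3"

definition c1 :: "gen \<Rightarrow> laurent" where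
  "c1 g = - (u g I1 * u g I2 + u g I1 * u g I3 + u g I2 * u g I3)"

definition c0 :: "gen \<Rightarrow> laurent" where "c0 g = u g I1 * u g I2 * u g I3"

definition c0_inv :: "gen \<Rightarrow> laurent" where "c0_inv g = u_inv g I1 * u_inv g I2 * u_inv g I3"

lemma c0_inv [simp]: "c0_inv g * c0 g = 1"
proof -
  have "c0_inv g * c0 g
      = (u_inv g I1 * u g I1) * (u_inv g I2 * u g I2) * (u_inv g I3 * u g I3)"
    unfolding c0_def c0_inv_def by (simp only: mult_ac)
  then show ?thesis by simp
qed

lemmas hscale_simps = hscale_mult_left hscale_mult_right hecke.scale_right_distrib
  hecke.scale_right_diff_distrib hecke.scale_left_distrib hecke.scale_left_diff_distrib
  distrib_left distrib_right left_diff_distrib right_diff_distrib mult.assoc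

lemma hgen_cube:
  "hgen g * (hgen g * hgen g)
    = hscale (c2 g) (hgen g * hgen g) + hscale (c1 g) (hgen g) + hscale (c0 g) 1"
proof -
  have 1: "hgen g - hconst c = hgen g - hscale c 1" for c by (simp add: hscale_def)
  show ?thesis
    using hecke_cubic[of g] unfolding 1
    by (simp add: hscale_simps c2_def c1_def c0_def algebra_simps)
qed

lemma hgen_square:
  "hgen g * hgen g
    = hscale (c2 g) (hgen g) + hscale (c1 g) 1 + hscale (c0 g) (unit_inv (hgen g))"
  using arg_cong[OF hgen_cube[of g], of "\<lambda>x. unit_inv (hgen g) * x"]
  by (simp add: hscale_simps)

lemma hgen_square_mult:
  "hgen g * (hgen g * x)
    = hscale (c2 g) (hgen g * x) + hscale (c1 g) x + hscale (c0 g) (unit_inv (hgen g) * x)"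
  using arg_cong[OF hgen_square[of g], of "\<lambda>y. y * x"] by (simp add: hscale_simps)

lemma hgen_inv:
  "unit_inv (hgen g)
    = hscale (c0_inv g) (hgen g * hgen g - hscale (c2 g) (hgen g) - hscale (c1 g) 1)"
  by (simp add: hgen_square)

text \<open>The cubic relation divided by the square of the generator: a positive power is traded
  for negative ones, which \<open>z\<close> can absorb.\<close>

lemma hgen_decomp:
  "hgen g = hscale (c2 g) 1 + hscale (c1 g) (unit_inv (hgen g))
    + hscale (c0 g) (unit_inv (hgen g) * unit_inv (hgen g))"
  using arg_cong[OF hgen_square[of g], of "\<lambda>x. unit_inv (hgen g) * x"]
  by (simp add: hscale_simps)

lemma mult_hgen_mult:
  "x * (hgen g * y) = hscale (c2 g) (x * y) + hscale (c1 g) (x * (unit_inv (hgen g) * y))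
    + hscale (c0 g) (x * (unit_inv (hgen g) * (unit_inv (hgen g) * y)))"
  using arg_cong[OF hgen_decomp[of g], of "\<lambda>w. x * (w * y)"] by (simp add: hscale_simps)

lemma z_eq: "z = s * (t * (s * t))" "z = t * (s * (t * s))"
  using hecke_braid by (simp_all add: z_def power2_eq_square mult.assoc)

lemma z_central: "x * z = z * x"
proof -
  \<comment> \<open>With \<open>z\<close> read as \<open>tsts\<close> on the left and
    \<open>stst\<close> on the right, both sides are the word \<open>ststs\<close>.\<close>
  have "s * z = z * s"
    by (subst z_eq(2), subst z_eq(1)) (simp add: mult.assoc)
  moreover have "t * z = z * t"
    by (subst z_eq(1), subst z_eq(2)) (simp add: mult.assoc)
  ultimately have gen: "hgen g * z = z * hgen g" for g
    by (cases g) auto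
  have step: "hgen g * x * z = z * (hgen g * x)" if "x * z = z * x" for g x
  proof -
    have "hgen g * x * z = hgen g * z * x" by (simp add: that mult.assoc)
    then show ?thesis by (simp add: gen mult.assoc)
  qed
  have "hecke.subspace {x. x * z = z * x}"
    by (auto simp: hecke.subspace_def hscale_simps)
  from hecke_induct[OF this, of x] show ?thesis
    by (auto simp: step)
qed

text \<open>Cancelling letters at the end of \<open>stst\<close> or \<open>tsts\<close>: inverses
  become positive words at the price of one factor \<open>z\<close>.\<close>

lemma z_inverses:
  "z * s_inv = t * (s * t)" "z * t_inv = s * (t * s)"
  "z * (s_inv * t_inv) = t * s" "z * (t_inv * s_inv) = s * t"
proof -
  show 1: "z * s_inv = t * (s * t)"
    by (subst z_central[symmetric], subst z_eq(1)) simp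
  show 2: "z * t_inv = s * (t * s)"
    by (subst z_central[symmetric], subst z_eq(2)) simp
  show "z * (s_inv * t_inv) = t * s" "z * (t_inv * s_inv) = s * t"
    by (simp_all add: 1 2 mult.assoc flip: mult.assoc[of z])
qed

section \<open>The submodule U\<close>

lemma subspace_u1: "hecke.subspace u1" and subspace_u2: "hecke.subspace u2"
  using subalgebra_hull by (simp_all add: u1_def u2_def subalgebra_def)

lemma u_mult: "x \<in> u1 \<Longrightarrow> y \<in> u1 \<Longrightarrow> x * y \<in> u1" "x \<in> u2 \<Longrightarrow> y \<in> u2 \<Longrightarrow> x * y \<in> u2"
  using subalgebra_hull by (simp_all add: u1_def u2_def subalgebra_def)

lemma u_one: "1 \<in> u1" "1 \<in> u2"
  using subalgebra_hull by (simp_all add: u1_def u2_def subalgebra_def)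

lemma u_gen: "s \<in> u1" "t \<in> u2"
  by (simp_all add: u1_def u2_def hull_inc)

lemma u_inverse: "s_inv \<in> u1" "t_inv \<in> u2"
  by (subst hgen_inv;
      intro hecke.subspace_scale hecke.subspace_diff subspace_u1 subspace_u2 u_mult u_one u_gen)+

text \<open>By the cubic relation, the span of 1, \<open>s\<close> and \<open>s_inv\<close> is
  stable under left multiplication by \<open>s\<close>, so it contains \<open>u1\<close>.\<close>

lemma u1_subset:
  assumes W: "hecke.subspace W" "1 \<in> W" "s \<in> W" "s_inv \<in> W"
  shows "u1 \<subseteq> W"
proof -
  let ?B = "{1, s, s_inv}"
  have gen: "hecke.span ?B \<subseteq> {x. s * x \<in> hecke.span ?B}"
  proof (rule hecke.span_minimal)
    have "1 \<in> hecke.span ?B" "s \<in> hecke.span ?B" "s_inv \<in> hecke.span ?B"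
      by (simp_all add: hecke.span_base)
    then show "?B \<subseteq> {x. s * x \<in> hecke.span ?B}"
      by (auto simp: hgen_square intro!: hecke.span_add hecke.span_scale)
  qed (intro subspace_mult_left_vimage hecke.subspace_span)
  have "u1 \<subseteq> hecke.span ?B"
    unfolding u1_def
    by (rule subalgebra_hull_subset) (use gen in \<open>auto intro: hecke.span_base\<close>)
  also have "\<dots> \<subseteq> W"
    by (rule hecke.span_minimal) (use W in auto)
  finally show ?thesis .
qed

lemma subspace_U: "hecke.subspace U"
  unfolding U_def by (intro subspace_set_sum subspace_set_plus subspace_span_prod) simp

lemma U_summand_subset:
  assumes "k \<le> 5"
  shows "{z ^ k} \<bullet> u1 \<bullet> u2 \<subseteq> U" "{z ^ k * t_inv * s} \<bullet> u2 \<subseteq> U"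
proof -
  let ?A = "{z ^ k} \<bullet> u1 \<bullet> u2" and ?B = "{z ^ k * t_inv * s} \<bullet> u2"
  have "?A + ?B \<subseteq> U"
    unfolding U_def using assms
    by (intro subset_set_sum[where F = "\<lambda>k. {z ^ k} \<bullet> u1 \<bullet> u2 + {z ^ k * t_inv * s} \<bullet> u2"]
        subspace_set_plus subspace_span_prod) auto
  moreover have "0 \<in> ?A" "0 \<in> ?B"
    by (intro hecke.subspace_0 subspace_span_prod)+
  ultimately show "?A \<subseteq> U" "?B \<subseteq> U"
    using set_plus_intro[of _ ?A 0 ?B] set_plus_intro[of 0 ?A _ ?B] by force+
qed

text \<open>Meant for \<open>W\<close> the preimage of \<open>U\<close> under a left multiplication:
  only four families of generators remain to be checked.\<close>

lemma U_subset:
  assumes W: "hecke.subspace W"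
    and u2: "\<And>x y. x \<in> W \<Longrightarrow> y \<in> u2 \<Longrightarrow> x * y \<in> W"
    and gens: "\<And>k. k \<le> 5 \<Longrightarrow> z ^ k \<in> W" "\<And>k. k \<le> 5 \<Longrightarrow> z ^ k * s \<in> W"
      "\<And>k. k \<le> 5 \<Longrightarrow> z ^ k * s_inv \<in> W" "\<And>k. k \<le> 5 \<Longrightarrow> z ^ k * (t_inv * s) \<in> W"
  shows "U \<subseteq> W"
proof -
  have u1: "u1 \<subseteq> {y. z ^ k * y \<in> W}" if "k \<le> 5" for k
    using gens[OF that] by (intro u1_subset subspace_mult_left_vimage W) auto
  have "{z ^ k} \<bullet> u1 \<subseteq> W" if "k \<le> 5" for k
    by (rule span_prod_subset[OF W]) (use u1[OF that] in auto)
  then have "{z ^ k} \<bullet> u1 \<bullet> u2 \<subseteq> W" if "k \<le> 5" for k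
    using that by (intro span_prod_subset[OF W]) (auto intro!: u2)
  moreover have "{z ^ k * t_inv * s} \<bullet> u2 \<subseteq> W" if "k \<le> 5" for k
    using gens(4)[OF that]
    by (intro span_prod_subset[OF W]) (use u2 in \<open>auto simp flip: mult.assoc\<close>)
  ultimately show ?thesis
    unfolding U_def by (intro set_sum_subset set_plus_subset W) auto
qed

lemma U_mult_u2:
  assumes "x \<in> U" "y \<in> u2"
  shows "x * y \<in> U"
proof -
  have right: "X \<bullet> u2 \<subseteq> {x. x * y \<in> X \<bullet> u2}" for X
    using assms(2)
    by (intro span_prod_subset subspace_mult_right_vimage subspace_span_prod)
      (auto simp: mult.assoc intro!: span_prod_memI u_mult)
  have "U \<subseteq> {x. x * y \<in> U}"
    using right U_summand_subset
    by (subst U_def, intro set_sum_subset set_plus_subset subspace_mult_right_vimage subspace_U)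
      fastforce+
  then show ?thesis using assms(1) by auto
qed

text \<open>The power of \<open>z\<close> is kept apart from \<open>x\<close>, so that each identity
  only shifts the exponent.\<close>

definition in_U :: "nat \<Rightarrow> hecke \<Rightarrow> bool" where "in_U k x \<longleftrightarrow> z ^ k * x \<in> U"

lemma in_U_add: "in_U k x \<Longrightarrow> in_U k y \<Longrightarrow> in_U k (x + y)"
  and in_U_diff: "in_U k x \<Longrightarrow> in_U k y \<Longrightarrow> in_U k (x - y)"
  and in_U_scale: "in_U k x \<Longrightarrow> in_U k (hscale c x)"
  using subspace_U
  by (simp_all add: in_U_def hscale_simps hecke.subspace_add hecke.subspace_diff
      hecke.subspace_scale)

lemma in_U_right: "in_U k x \<Longrightarrow> y \<in> u2 \<Longrightarrow> in_U k (x * y)"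
  using U_mult_u2 by (simp add: in_U_def flip: mult.assoc)

lemma in_U_u1: "k \<le> 5 \<Longrightarrow> x \<in> u1 \<Longrightarrow> in_U k x"
  using U_summand_subset(1)[of k] span_prod_memI[of "z ^ k" "{z ^ k}" x u1]
    span_prod_memI[of "z ^ k * x" "{z ^ k} \<bullet> u1" 1 u2] u_one
  by (auto simp: in_U_def)

lemma in_U_u1_u2: "k \<le> 5 \<Longrightarrow> x \<in> u1 \<Longrightarrow> y \<in> u2 \<Longrightarrow> in_U k (x * y)"
  by (intro in_U_right in_U_u1)

lemma in_U_u2: "k \<le> 5 \<Longrightarrow> y \<in> u2 \<Longrightarrow> in_U k y"
  using in_U_u1_u2[of k 1 y] u_one by simp

lemma in_U_t_inv_s: "k \<le> 5 \<Longrightarrow> in_U k (t_inv * s)"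
  using U_summand_subset(2)[of k]
    span_prod_memI[of "z ^ k * t_inv * s" "{z ^ k * t_inv * s}" 1 u2] u_one
  by (auto simp: in_U_def mult.assoc)

lemma in_U_z: "in_U k (z * x) \<longleftrightarrow> in_U (Suc k) x"
  by (simp only: in_U_def power_Suc2 mult.assoc)

lemma in_U_unscale: "in_U k (hscale (c0 g) x) \<Longrightarrow> in_U k x"
  using in_U_scale[of k "hscale (c0 g) x" "c0_inv g"] by simp

lemma in_U_right_cancel: "in_U k (x * t_inv) \<Longrightarrow> in_U k x"
  using in_U_right[of k "x * t_inv" t] u_gen by (simp add: mult.assoc)

section \<open>Closure of U under left multiplication\<close>

lemma mult_z_left: "x * (z * y) = z * (x * y)"
  using arg_cong[OF z_central[of x], of "\<lambda>w. w * y"] by (simp add: mult.assoc)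

lemma ts_eq: "t * s = z * (s_inv * t_inv)"
  by (simp add: z_inverses)

lemma t_inv_s_inv: "z * (t_inv * (s_inv * x)) = s * (t * x)"
  using arg_cong[OF z_inverses(4), of "\<lambda>y. y * x"] by (simp add: mult.assoc)

text \<open>Expand \<open>s\<close> on the left in 1, \<open>s\<^sup>-\<^sup>1\<close> and \<open>s\<^sup>-\<^sup>2\<close>: the last term is
  \<open>z\<^sup>2 t\<^sup>-\<^sup>1 s\<^sup>-\<^sup>2 t\<^sup>-\<^sup>1 = s t\<^sup>2 s\<close>, in which \<open>t\<^sup>2\<close> is expanded.\<close>

lemma t_inv_s_t_inv:
  "z * (z * (t_inv * (s * t_inv)))
    = hscale (c0 S * c0 T) (s * (t_inv * s))
    + hscale (c2 S) (z * (z * (t_inv * t_inv)))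
    + hscale (c1 S) (z * s)
    + hscale (c0 S * c2 T) (z * t_inv)
    + hscale (c0 S * c1 T) (s * s)"
proof -
  have 1: "z * (z * (t_inv * (s_inv * t_inv))) = z * s"
    by (simp add: t_inv_s_inv)
  have "z * (z * (t_inv * (s_inv * (s_inv * t_inv)))) = s * (t * (z * (s_inv * t_inv)))"
    by (simp add: t_inv_s_inv mult_z_left[of s] mult_z_left[of t])
  also have "\<dots> = s * (t * (t * s))"
    by (simp add: ts_eq)
  also have "\<dots> = hscale (c2 T) (z * t_inv) + hscale (c1 T) (s * s)
      + hscale (c0 T) (s * (t_inv * s))"
    by (simp add: hgen_square_mult hscale_simps z_inverses)
  finally have 2: "z * (z * (t_inv * (s_inv * (s_inv * t_inv)))) = \<dots>" .
  show ?thesis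
    using mult_hgen_mult[of "z * (z * t_inv)" S t_inv]
    by (simp add: mult.assoc 1 2 hscale_simps)
qed

lemma mult_t_inv_s_t_inv:
  "z * (z * (x * (t_inv * s) * t_inv))
    = hscale (c0 S) (hscale (c0 T) (x * (s * (t_inv * s))))
    + hscale (c2 S) (z * (z * (x * t_inv * t_inv)))
    + hscale (c1 S) (z * (x * s))
    + hscale (c0 S * c2 T) (z * (x * t_inv))
    + hscale (c0 S * c1 T) (x * (s * s))"
proof -
  have "z * (z * (x * (t_inv * s) * t_inv)) = x * (z * (z * (t_inv * (s * t_inv))))"
    by (simp add: mult.assoc mult_z_left[of x])
  then show ?thesis
    by (simp add: t_inv_s_t_inv hscale_simps mult_z_left[of x])
qed

text \<open>The basic relation multiplied by \<open>x\<close> gives \<open>x t^-1 s t^-1\<close>;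
  the last factor is removed since \<open>U\<close> is stable under \<open>u2\<close> on the
  right.\<close>

lemma in_U_raise:
  assumes "in_U k (x * (s * (t_inv * s)))" "in_U (Suc (Suc k)) x" "in_U (Suc k) x"
    "in_U (Suc k) (x * s)" "in_U k (x * (s * s))"
  shows "in_U (Suc (Suc k)) (x * (t_inv * s))"
proof -
  have "in_U k (z * (z * (x * (t_inv * s) * t_inv)))"
    unfolding mult_t_inv_s_t_inv using assms
    by (intro in_U_add in_U_scale) (simp_all add: in_U_z in_U_right u_inverse)
  then show ?thesis
    by (simp add: in_U_z in_U_right_cancel)
qed

text \<open>The same relation solved for its term in \<open>s t^-1 s\<close>, whose coefficient is a
  unit.\<close>

lemma in_U_lower:
  assumes "in_U (Suc (Suc k)) (x * (t_inv * s))" "in_U (Suc (Suc k)) x" "in_U (Suc k) x"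
    "in_U (Suc k) (x * s)" "in_U k (x * (s * s))"
  shows "in_U k (x * (s * (t_inv * s)))"
proof -
  have "hscale (c0 S) (hscale (c0 T) (x * (s * (t_inv * s))))
    = z * (z * (x * (t_inv * s) * t_inv)) - hscale (c2 S) (z * (z * (x * t_inv * t_inv)))
      - hscale (c1 S) (z * (x * s)) - hscale (c0 S * c2 T) (z * (x * t_inv))
      - hscale (c0 S * c1 T) (x * (s * s))"
    by (simp only: mult_t_inv_s_t_inv) simp
  also have "in_U k \<dots>"
    using assms by (intro in_U_diff in_U_scale) (simp_all add: in_U_z in_U_right u_inverse)
  finally show ?thesis by (rule in_U_unscale[OF in_U_unscale])
qed

section \<open>Stability under \<open>s\<close>, with the products it needs\<close>

lemma in_U_t_s:
  assumes "k \<le> 4"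
  shows "in_U k (t * s)"
  \<comment> \<open>This raises the exponent by one, hence the bound 4; exponent 5 needs a separate
    argument.\<close>
  unfolding ts_eq in_U_z using assms by (intro in_U_u1_u2 u_inverse) simp

lemma in_U_t_s_inv_pos:
  assumes "1 \<le> k" "k \<le> 5"
  shows "in_U k (t * s_inv)"
proof -
  obtain i where i: "k = Suc i" using assms by (cases k) auto
  \<comment> \<open>One factor \<open>z\<close> is spent on \<open>z s^-1 = tst\<close>, and then
    \<open>t^2\<close> is expanded in \<open>t^2 s t\<close>.\<close>
  have "z * (t * s_inv) = hscale (c2 T) (z * s_inv) + hscale (c1 T) (s * t)
      + hscale (c0 T) (t_inv * s * t)"
    by (simp add: z_inverses mult_z_left[of t, symmetric] hgen_square_mult hscale_simps)
  moreover have "in_U i (t_inv * s * t)" "in_U i (s * t)" "in_U i (z * s_inv)"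
    using assms i
    by (simp_all add: in_U_z in_U_right in_U_t_inv_s in_U_u1_u2 in_U_u1 u_gen u_inverse)
  ultimately show ?thesis
    unfolding i in_U_z[symmetric] by (auto intro!: in_U_add in_U_scale)
qed

text \<open>For \<open>k \<le> 3\<close> the exponent may grow by 2. For \<open>k \<ge> 4\<close> the claim is raised from \<open>k - 2\<close>,
  where \<open>s\<^sup>2 t\<^sup>-\<^sup>1 s\<close> is reduced by the cubic relation.\<close>

lemma in_U_s_t_inv_s:
  assumes "k \<le> 5"
  shows "in_U k (s * (t_inv * s))"
proof -
  have low: "in_U k (s * (t_inv * s))" if "k \<le> 3" for k
    using that in_U_lower[of k 1]
    by (simp add: in_U_u1 in_U_t_inv_s u_mult u_gen u_one)
  show ?thesis
  proof (cases "k \<le> 3")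
    case False
    with assms obtain j where j: "k = Suc (Suc (Suc j))" "1 \<le> j" "j \<le> 2"
      by (intro that[of "k - 3"]) auto
    have "z * (s_inv * (t_inv * s)) = t * (s * s)"
      using arg_cong[OF z_inverses(3), of "\<lambda>y. y * s"] by (simp add: mult.assoc)
    also have "\<dots> = hscale (c2 S) (t * s) + hscale (c1 S) t + hscale (c0 S) (t * s_inv)"
      by (simp add: hgen_square hscale_simps)
    also have "in_U j \<dots>"
      using j by (intro in_U_add in_U_scale in_U_t_s in_U_t_s_inv_pos in_U_u2 u_gen) auto
    finally have "in_U (Suc j) (s_inv * (t_inv * s))" by (simp add: in_U_z)
    then have "in_U (Suc j) (s * (s * (t_inv * s)))"
      unfolding hgen_square_mult[of S] using j
      by (intro in_U_add in_U_scale low in_U_t_inv_s) auto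
    then show ?thesis
      unfolding j(1) by (rule in_U_raise) (use j in \<open>auto intro!: in_U_u1 u_mult u_gen\<close>)
  qed (rule low)
qed

text \<open>Since \<open>z\<close> is central, \<open>x\<close> moves past \<open>z^k\<close>, and
  the four families of generators decide stability.\<close>

lemma in_U_mult_left:
  assumes "\<And>k. k \<le> 5 \<Longrightarrow> in_U k x" "\<And>k. k \<le> 5 \<Longrightarrow> in_U k (x * s)"
    "\<And>k. k \<le> 5 \<Longrightarrow> in_U k (x * s_inv)" "\<And>k. k \<le> 5 \<Longrightarrow> in_U k (x * (t_inv * s))"
    and y: "in_U k y"
  shows "in_U k (x * y)"
proof -
  have "z * x = x * z" by (rule z_central[symmetric])
  then have "x * z ^ k = z ^ k * x" for k
    by (rule power_commuting_commutes[symmetric])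
  then have comm: "x * (z ^ k * w) = z ^ k * (x * w)" for k w
    by (metis mult.assoc)
  have "U \<subseteq> {y. x * y \<in> U}"
  proof (intro U_subset subspace_mult_left_vimage subspace_U)
    fix k :: nat assume "k \<le> 5"
    then show "z ^ k \<in> {y. x * y \<in> U}" "z ^ k * s \<in> {y. x * y \<in> U}"
      "z ^ k * s_inv \<in> {y. x * y \<in> U}" "z ^ k * (t_inv * s) \<in> {y. x * y \<in> U}"
      using assms(1-4)[of k] comm[of k 1] by (simp_all add: in_U_def comm)
  qed (auto simp: U_mult_u2 simp flip: mult.assoc)
  then show ?thesis using y comm by (auto simp: in_U_def)
qed

lemma in_U_s_mult: "in_U k x \<Longrightarrow> in_U k (s * x)"
proof (rule in_U_mult_left)
  fix k :: nat assume "k \<le> 5"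
  then show "in_U k s" "in_U k (s * s)" "in_U k (s * s_inv)" "in_U k (s * (t_inv * s))"
    using in_U_s_t_inv_s by (simp_all add: in_U_u1 u_mult u_gen u_one)
qed

section \<open>Stability under \<open>t\<close>\<close>

lemma in_U_s_inv_mult:
  assumes "in_U k x"
  shows "in_U k (s_inv * x)"
proof -
  have "s_inv * x = hscale (c0_inv S) (s * (s * x) - hscale (c2 S) (s * x) - hscale (c1 S) x)"
    by (subst hgen_inv) (simp add: hscale_simps)
  also have "in_U k \<dots>"
    by (intro in_U_scale in_U_diff in_U_s_mult assms)
  finally show ?thesis .
qed

lemma in_U_t_s_inv:
  assumes "k \<le> 5"
  shows "in_U k (t * s_inv)"
proof (cases "k = 0")
  case True
  \<comment> \<open>At exponent 0 there is no \<open>z\<close> to spend. Expanding \<open>s\<close>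
    produces \<open>z t^-1 s^-2 = s t s^-1\<close>, and stability under \<open>s^-1\<close> strips
    the leading \<open>s\<close>.\<close>
  have "z * (t_inv * s) = hscale (c2 S) (z * t_inv) + hscale (c1 S) (s * t)
      + hscale (c0 S) (s * (t * s_inv))"
    using mult_hgen_mult[of "z * t_inv" S 1]
    by (simp only: mult.assoc t_inv_s_inv z_inverses(4) mult_1_right)
  then have "hscale (c0 S) (s * (t * s_inv))
      = z * (t_inv * s) - hscale (c2 S) (z * t_inv) - hscale (c1 S) (s * t)"
    by simp
  also have "in_U 0 \<dots>"
    by (intro in_U_diff in_U_scale in_U_s_mult; (simp only: in_U_z)?)
      (auto intro!: in_U_t_inv_s in_U_u2 u_inverse u_gen)
  finally have "in_U 0 (s_inv * (s * (t * s_inv)))"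
    by (rule in_U_s_inv_mult[OF in_U_unscale])
  then show ?thesis by (simp add: True)
qed (use assms in_U_t_s_inv_pos in auto)

lemma in_U_t_inv_u1:
  assumes "1 \<le> k" "k \<le> 5" "x \<in> u1"
  shows "in_U k (t_inv * x)"
proof -
  obtain i where i: "k = Suc i" using assms by (cases k) auto
  have "u1 \<subseteq> {x. z ^ k * t_inv * x \<in> U}"
  proof (intro u1_subset subspace_mult_left_vimage subspace_U)
    have "in_U i (z * (t_inv * s_inv))"
      unfolding z_inverses using i assms by (intro in_U_u1_u2 u_gen) simp
    then have "in_U k (t_inv * s_inv)" by (simp add: in_U_z i)
    moreover have "in_U k t_inv" "in_U k (t_inv * s)"
      using assms by (simp_all add: in_U_t_inv_s in_U_u2 u_inverse)
    ultimately show "1 \<in> {x. z ^ k * t_inv * x \<in> U}" "s \<in> {x. z ^ k * t_inv * x \<in> U}"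
      "s_inv \<in> {x. z ^ k * t_inv * x \<in> U}"
      by (simp_all add: in_U_def mult.assoc)
  qed
  then show ?thesis
    using assms(3) by (auto simp: in_U_def mult.assoc)
qed

text \<open>Used both ways: up to terms already in \<open>U\<close>, \<open>t s\<close> is a unit
  multiple of \<open>t^-2 s\<close>.\<close>

lemma t_s_expand:
  "t * s = hscale (c2 T) s + hscale (c1 T) (t_inv * s) + hscale (c0 T) (t_inv * (t_inv * s))"
  using mult_hgen_mult[of 1 T s] by simp

lemma in_U_t_inv_t_inv_s:
  assumes "k \<le> 4"
  shows "in_U k (t_inv * (t_inv * s))"
proof -
  have "hscale (c0 T) (t_inv * (t_inv * s))
      = t * s - hscale (c2 T) s - hscale (c1 T) (t_inv * s)"
    by (simp add: t_s_expand)
  also have "in_U k \<dots>"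
    using assms by (intro in_U_diff in_U_scale in_U_t_s in_U_u1 in_U_t_inv_s u_gen) auto
  finally show ?thesis by (rule in_U_unscale)
qed

text \<open>As \<open>t s\<close> reduces to \<open>t\<^sup>-\<^sup>2 s\<close>, the exponent is raised twice: from 1 for \<open>t\<^sup>-\<^sup>1 s\<^sup>2 t\<^sup>-\<^sup>1 s\<close> to 3
  for \<open>t\<^sup>-\<^sup>1 s t\<^sup>-\<^sup>1 s\<close> to 5 for \<open>t\<^sup>-\<^sup>2 s\<close>.\<close>

lemma in_U_t_s_5: "in_U 5 (t * s)"
proof -
  note intros = in_U_t_inv_u1 u_mult u_gen u_one in_U_u2 u_inverse
  have "z * (t_inv * (s_inv * (t_inv * s))) = s * s"
    by (simp add: t_inv_s_inv)
  moreover have "in_U 0 (s * s)"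
    by (intro in_U_u1 u_mult u_gen) simp
  ultimately have "in_U 1 (t_inv * (s_inv * (t_inv * s)))"
    by (simp flip: in_U_z)
  \<comment> \<open>A trade downwards with \<open>x = t^-1\<close>, from \<open>t^-2 s\<close> at
    exponent 3, which is within the known range.\<close>
  moreover have "in_U 1 (t_inv * (s * (t_inv * s)))"
    by (rule in_U_lower) (simp_all add: in_U_t_inv_t_inv_s intros)
  ultimately have "in_U 1 (t_inv * s * (s * (t_inv * s)))"
    by (simp add: mult.assoc hgen_square_mult[of S] hscale_simps in_U_add in_U_scale
        in_U_t_inv_t_inv_s)
  then have "in_U (Suc (Suc 1)) (t_inv * s * (t_inv * s))"
    by (rule in_U_raise) (simp_all add: mult.assoc intros)
  then have "in_U (Suc (Suc 3)) (t_inv * (t_inv * s))"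
    by (intro in_U_raise) (simp_all add: mult.assoc eval_nat_numeral intros)
  then have "in_U 5 (t_inv * (t_inv * s))"
    by (simp add: eval_nat_numeral)
  then show ?thesis
    by (simp add: t_s_expand in_U_add in_U_scale in_U_u1 in_U_t_inv_s u_gen)
qed

lemma in_U_t_mult: "in_U k x \<Longrightarrow> in_U k (t * x)"
proof (rule in_U_mult_left)
  fix k :: nat assume "k \<le> 5"
  then show "in_U k (t * s)"
    using in_U_t_s[of k] in_U_t_s_5 by (cases "k = 5") auto
qed (simp_all add: in_U_u2 in_U_u1 in_U_t_s_inv u_gen)

theorem theorem4p2p4:
  shows "(UNIV :: hecke set) = U"
proof -
  have "1 \<in> U"
    using in_U_u1[of 0 1] u_one by (simp add: in_U_def)
  moreover have "s * x \<in> U" "t * x \<in> U" if "x \<in> U" for x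
    using that in_U_s_mult[of 0 x] in_U_t_mult[of 0 x] by (simp_all add: in_U_def)
  ultimately have "x \<in> U" for x
    by (rule hecke_induct[OF subspace_U])
  then show ?thesis by blast
qed

end
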